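(* For any two distinct points in $\mathfrak{T}_1$, there exists a bigeodesic (with respect to the metric $\eta$) in $\mathfrak{T}_1$ joining them.
   Context: $\mathbb{R}_+^*$ denotes the set of positive reals. $\mathfrak{T}_1=\{(A_1,A_2,A_3)\in(\mathbb{R}_+^* )^3:(A_1+A_2+A_3)A_1A_2A_3=1\}$ (the space of marked unit area Euclidean triangles). The metric $\eta$ on $\mathfrak{T}_1$ (not symmetric) is $\eta((A_1,A_2,A_3),(A_1',A_2',A_3'))=\log\max\{A_1'/A_1,A_2'/A_2,A_3'/A_3\}$. $\mathfrak{T}_1$ carries the topology induced by the symmetric metric $\max\{\eta(X,Y),\eta(Y,X)\}$. A continuous path $\alpha:[a,b]\to X$ in a (possibly non-symmetric) metric space $(X,d)$ is a geodesic if $d(\alpha(u),\alpha(w))=d(\alpha(u),\alpha(v))+d(\alpha(v),\alpha(w))$ for all $u\le v\le w$ in $[a,b]$. It is a bigeodesic if both $\alpha$ and the same path traversed in the reverse direction are geodesics. A path $\alpha:[a,b]\to X$ joins $x$ and $y$ if $\alpha(a)=x$ and $\alpha(b)=y$. *)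

theory Defs
  imports "HOL-Analysis.Analysis"
begin

definition T1 :: "(real \<times> real \<times> real) set" where
  "T1 = {(A1, A2, A3). A1 > 0 \<and> A2 > 0 \<and> A3 > 0 \<and> (A1 + A2 + A3) * A1 * A2 * A3 = 1}"

fun eta :: "real \<times> real \<times> real \<Rightarrow> real \<times> real \<times> real \<Rightarrow> real" where
  "eta (A1, A2, A3) (B1, B2, B3) = ln (Max {B1 / A1, B2 / A2, B3 / A3})"

declare eta.simps [simp del]

text \<open>The locale \<open>Metric_space\<close> requires the distance to be nonnegative on the whole type, so
  its value outside the carrier \<open>X\<close> is set to 0; this does not affect the topology.\<close>

definition symmetrized :: "'a set \<Rightarrow> ('a \<Rightarrow> 'a \<Rightarrow> real) \<Rightarrow> 'a \<Rightarrow> 'a \<Rightarrow> real" where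
  "symmetrized X d x y = (if x \<in> X \<and> y \<in> X then max (d x y) (d y x) else 0)"

text \<open>The pair \<open>(X, d)\<close> is a possibly non-symmetric metric space. It carries the topology of
  the symmetrized metric, and paths are continuous for that topology; the continuity condition
  includes that \<open>\<alpha>\<close> maps the interval into \<open>X\<close>. The condition \<open>a \<le> b\<close> excludes an
  empty parameter interval.\<close>

definition geodesic_on ::
  "'a set \<Rightarrow> ('a \<Rightarrow> 'a \<Rightarrow> real) \<Rightarrow> real \<Rightarrow> real \<Rightarrow> (real \<Rightarrow> 'a) \<Rightarrow> bool" where
  "geodesic_on X d a b \<alpha> \<longleftrightarrow>
     a \<le> b \<and>
     continuous_map (top_of_set {a..b}) (Metric_space.mtopology X (symmetrized X d)) \<alpha> \<and>
     (\<forall>u\<in>{a..b}. \<forall>v\<in>{a..b}. \<forall>w\<in>{a..b}. u \<le> v \<and> v \<le> w \<longrightarrow>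
        d (\<alpha> u) (\<alpha> w) = d (\<alpha> u) (\<alpha> v) + d (\<alpha> v) (\<alpha> w))"

definition bigeodesic_on ::
  "'a set \<Rightarrow> ('a \<Rightarrow> 'a \<Rightarrow> real) \<Rightarrow> real \<Rightarrow> real \<Rightarrow> (real \<Rightarrow> 'a) \<Rightarrow> bool" where
  "bigeodesic_on X d a b \<alpha> \<longleftrightarrow>
     geodesic_on X d a b \<alpha> \<and> geodesic_on X d a b (\<lambda>t. \<alpha> (a + b - t))"

text \<open>\<open>Metric_space.mtopology\<close> is meaningful for \<open>symmetrized T1 eta\<close>, because the latter is a
  metric on \<open>T1\<close>.\<close>

lemma eta_eq_max:
  assumes "A1 > 0" "A2 > 0" "A3 > 0" "B1 > 0" "B2 > 0" "B3 > 0"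
  shows "eta (A1, A2, A3) (B1, B2, B3) =
    max (ln B1 - ln A1) (max (ln B2 - ln A2) (ln B3 - ln A3))"
proof -
  have ln_max: "ln (max x y) = max (ln x) (ln y)" if "x > 0" "y > 0" for x y :: real
    using that by (auto simp: max_def)
  have "Max {B1 / A1, B2 / A2, B3 / A3} = max (B1 / A1) (max (B2 / A2) (B3 / A3))"
    by simp
  moreover have "max (B2 / A2) (B3 / A3) > 0"
    using assms by (simp add: less_max_iff_disj)
  ultimately show ?thesis
    using assms by (simp add: eta.simps ln_max ln_div)
qed

lemma symmetrized_eta:
  assumes "(A1, A2, A3) \<in> T1" "(B1, B2, B3) \<in> T1"
  shows "symmetrized T1 eta (A1, A2, A3) (B1, B2, B3) =
    max \<bar>ln B1 - ln A1\<bar> (max \<bar>ln B2 - ln A2\<bar> \<bar>ln B3 - ln A3\<bar>)"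
proof -
  have "A1 > 0" "A2 > 0" "A3 > 0" "B1 > 0" "B2 > 0" "B3 > 0"
    using assms by (auto simp: T1_def)
  then have "symmetrized T1 eta (A1, A2, A3) (B1, B2, B3) =
    max (max (ln B1 - ln A1) (max (ln B2 - ln A2) (ln B3 - ln A3)))
        (max (ln A1 - ln B1) (max (ln A2 - ln B2) (ln A3 - ln B3)))"
    using assms by (simp add: symmetrized_def eta_eq_max)
  also have "\<dots> = max \<bar>ln B1 - ln A1\<bar> (max \<bar>ln B2 - ln A2\<bar> \<bar>ln B3 - ln A3\<bar>)"
    by linarith
  finally show ?thesis .
qed

lemma Metric_space_T1: "Metric_space T1 (symmetrized T1 eta)"
proof
  fix x y :: "real \<times> real \<times> real"
  show "symmetrized T1 eta x y = symmetrized T1 eta y x"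
    by (simp add: symmetrized_def max.commute)
next
  fix x y :: "real \<times> real \<times> real"
  show "0 \<le> symmetrized T1 eta x y"
  proof (cases "x \<in> T1 \<and> y \<in> T1")
    case True
    then show ?thesis
      by (cases x; cases y) (simp add: symmetrized_eta le_max_iff_disj)
  qed (auto simp: symmetrized_def)
next
  fix x y :: "real \<times> real \<times> real"
  assume T1: "x \<in> T1" "y \<in> T1"
  obtain A1 A2 A3 B1 B2 B3 where xy: "x = (A1, A2, A3)" "y = (B1, B2, B3)"
    by (cases x; cases y) auto
  have pos: "A1 > 0" "A2 > 0" "A3 > 0" "B1 > 0" "B2 > 0" "B3 > 0"
    using T1 xy by (auto simp: T1_def)
  have "symmetrized T1 eta x y = max \<bar>ln B1 - ln A1\<bar> (max \<bar>ln B2 - ln A2\<bar> \<bar>ln B3 - ln A3\<bar>)"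
    using T1 xy by (simp add: symmetrized_eta)
  then have "symmetrized T1 eta x y = 0 \<longleftrightarrow> ln A1 = ln B1 \<and> ln A2 = ln B2 \<and> ln A3 = ln B3"
    by linarith
  then show "symmetrized T1 eta x y = 0 \<longleftrightarrow> x = y"
    using pos xy by simp
next
  fix x y z :: "real \<times> real \<times> real"
  assume *: "x \<in> T1" "y \<in> T1" "z \<in> T1"
  obtain A1 A2 A3 B1 B2 B3 C1 C2 C3
    where xyz: "x = (A1, A2, A3)" "y = (B1, B2, B3)" "z = (C1, C2, C3)"
    by (cases x; cases y; cases z) auto
  have abs_triangle: "\<bar>c - a\<bar> \<le> r + s" if "\<bar>b - a\<bar> \<le> r" "\<bar>c - b\<bar> \<le> s" for a b c r s :: real
    using that by linarith
  show "symmetrized T1 eta x z \<le> symmetrized T1 eta x y + symmetrized T1 eta y z"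
    using * unfolding xyz
    by (simp only: symmetrized_eta max.bounded_iff)
       (intro conjI abs_triangle[of "ln B1" "ln A1" _ "ln C1"] abs_triangle[of "ln B2" "ln A2" _ "ln C2"]
          abs_triangle[of "ln B3" "ln A3" _ "ln C3"]; simp add: le_max_iff_disj)
qed

end

(* In the coordinates a_i = ln A_i, the asymmetric distance eta is the maximum of the coordinate
   increments. Adding a constant c to all a_i multiplies (A_1 + A_2 + A_3) A_1 A_2 A_3 by exp (4 c),
   so every line in direction (1,1,1) meets T1 exactly once. Project the straight segment
   between two points to T1 along this direction. The projection adds the same amount to all
   increments, so over a time interval of length r the maximal increment is r times the maximal
   slope plus the change of a common function, and this is additive. Exchanging the endpoints
   reverses the path. *)

theory Submission imports Defs begin

text \<open>By Heron's formula, for positive arguments this is the square root of the area of the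
  triangle with sides A1 + A2, A2 + A3, A3 + A1. The radicand is homogeneous of degree 4, so
  dividing all three arguments by the root makes it 1.\<close>

definition area_root :: "real \<Rightarrow> real \<Rightarrow> real \<Rightarrow> real" where
  "area_root A1 A2 A3 = ((A1 + A2 + A3) * A1 * A2 * A3) powr (1/4)"

definition geom_mean :: "real \<Rightarrow> real \<Rightarrow> real \<Rightarrow> real" where
  "geom_mean A B t = A powr (1 - t) * B powr t"

fun project_T1 :: "real \<times> real \<times> real \<Rightarrow> real \<times> real \<times> real" where
  "project_T1 (A1, A2, A3) =
     (A1 / area_root A1 A2 A3, A2 / area_root A1 A2 A3, A3 / area_root A1 A2 A3)"

fun seg :: "real \<times> real \<times> real \<Rightarrow> real \<times> real \<times> real \<Rightarrow> real \<Rightarrow> real \<times> real \<times> real" where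
  "seg (A1, A2, A3) (B1, B2, B3) t =
     project_T1 (geom_mean A1 B1 t, geom_mean A2 B2 t, geom_mean A3 B3 t)"

text \<open>Unfolding \<open>seg\<close> then stops at \<open>project_T1\<close>, where
  \<open>project_in_T1\<close> and \<open>project_T1_eq\<close> apply.\<close>

declare project_T1.simps [simp del]

lemma area_root_pos:
  assumes "A1 > 0" "A2 > 0" "A3 > 0"
  shows "area_root A1 A2 A3 > 0"
  using assms by (simp add: area_root_def add_eq_0_iff less_le)

lemma area_root_power4:
  assumes "A1 > 0" "A2 > 0" "A3 > 0"
  shows "area_root A1 A2 A3 ^ 4 = (A1 + A2 + A3) * A1 * A2 * A3"
proof -
  have "(A1 + A2 + A3) * A1 * A2 * A3 > 0"
    using assms by simp
  then show ?thesis
    by (simp add: area_root_def powr_powr flip: powr_numeral)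
qed

lemma geom_mean_pos: "A > 0 \<Longrightarrow> B > 0 \<Longrightarrow> geom_mean A B t > 0"
  by (simp add: geom_mean_def)

lemma ln_geom_mean:
  "A > 0 \<Longrightarrow> B > 0 \<Longrightarrow> ln (geom_mean A B t) = ln A + t * (ln B - ln A)"
  by (simp add: geom_mean_def ln_mult algebra_simps)

lemma geom_mean_commute: "geom_mean A B (1 - t) = geom_mean B A t"
  by (simp add: geom_mean_def)

lemma continuous_on_geom_mean:
  "A > 0 \<Longrightarrow> B > 0 \<Longrightarrow> continuous_on S (geom_mean A B)"
  unfolding geom_mean_def by (intro continuous_intros) auto

lemma project_in_T1:
  assumes "A1 > 0" "A2 > 0" "A3 > 0"
  shows "project_T1 (A1, A2, A3) \<in> T1"
proof -
  define r where "r = area_root A1 A2 A3"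
  have r: "r > 0" "r ^ 4 = (A1 + A2 + A3) * A1 * A2 * A3"
    using area_root_pos area_root_power4 assms by (auto simp: r_def)
  have "(A1 / r + A2 / r + A3 / r) * (A1 / r) * (A2 / r) * (A3 / r)
      = ((A1 + A2 + A3) * A1 * A2 * A3) / r ^ 4"
    by (simp add: add_divide_distrib [symmetric] power4_eq_xxxx)
  also have "\<dots> = 1"
    using r by (metis divide_self power_eq_0_iff less_irrefl)
  finally show ?thesis
    using assms r(1)
    by (simp add: T1_def project_T1.simps del: times_divide_eq_left times_divide_eq_right flip: r_def)
qed

lemma project_T1_eq: "x \<in> T1 \<Longrightarrow> project_T1 x = x"
  by (auto simp: T1_def project_T1.simps area_root_def)

lemma seg_in_T1: "x \<in> T1 \<Longrightarrow> y \<in> T1 \<Longrightarrow> seg x y t \<in> T1"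
  by (cases x; cases y; simp; rule project_in_T1) (auto simp: T1_def geom_mean_pos)

text \<open>Membership in \<open>T1\<close> supplies positive coordinates, which matters for
  \<open>B powr 0 = 1\<close>, because \<open>0 powr 0 = 0\<close>.\<close>

lemma seg_0: "x \<in> T1 \<Longrightarrow> y \<in> T1 \<Longrightarrow> seg x y 0 = x"
  using project_T1_eq [of x]
  by (cases x; cases y) (auto simp: T1_def geom_mean_def)

text \<open>Reduces both the endpoint at 1 and the reversed path to facts about
  \<open>seg y x\<close>.\<close>

lemma seg_commute: "seg x y (1 - t) = seg y x t"
  by (cases x; cases y) (simp add: geom_mean_commute)

text \<open>What counts is that \<open>D\<close> and \<open>c\<close> do not depend on
  \<open>u\<close> and \<open>v\<close>: both terms of the distance then telescope. Here
  \<open>D\<close> is the largest logarithmic slope and \<open>c\<close> the logarithm of the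
  normalizing root.\<close>

lemma eta_seg:
  assumes "x \<in> T1" "y \<in> T1"
  obtains D c where "\<And>u v. u \<le> v \<Longrightarrow> eta (seg x y u) (seg x y v) = (v - u) * D - (c v - c u)"
proof -
  obtain A1 A2 A3 B1 B2 B3 where xy: "x = (A1, A2, A3)" "y = (B1, B2, B3)"
    by (cases x; cases y) auto
  have pos: "A1 > 0" "A2 > 0" "A3 > 0" "B1 > 0" "B2 > 0" "B3 > 0"
    using assms xy by (auto simp: T1_def)
  define r where "r t = area_root (geom_mean A1 B1 t) (geom_mean A2 B2 t) (geom_mean A3 B3 t)" for t
  have r: "r t > 0" for t
    using pos by (simp add: r_def area_root_pos geom_mean_pos)
  define d1 d2 d3 where "d1 = ln B1 - ln A1" and "d2 = ln B2 - ln A2" and "d3 = ln B3 - ln A3"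
  have "eta (seg x y u) (seg x y v) = (v - u) * max d1 (max d2 d3) - (ln (r v) - ln (r u))"
    if "u \<le> v" for u v
  proof -
    \<comment> \<open>The normalization shifts all three logarithmic increments by this same
      \<open>k\<close>, so it can be taken out of the maximum.\<close>
    define k where "k = ln (r v) - ln (r u)"
    have ln_diff: "ln (geom_mean A B v / r v) - ln (geom_mean A B u / r u) = (v - u) * (ln B - ln A) - k"
      if "A > 0" "B > 0" for A B
    proof -
      have "ln (geom_mean A B s / r s) = ln A + s * (ln B - ln A) - ln (r s)" for s
        using that r [of s] geom_mean_pos [of A B s] by (simp add: ln_div ln_geom_mean)
      then show ?thesis
        by (simp add: k_def left_diff_distrib)
    qed
    have "eta (seg x y u) (seg x y v) =
        max (ln (geom_mean A1 B1 v / r v) - ln (geom_mean A1 B1 u / r u))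
          (max (ln (geom_mean A2 B2 v / r v) - ln (geom_mean A2 B2 u / r u))
            (ln (geom_mean A3 B3 v / r v) - ln (geom_mean A3 B3 u / r u)))"
      unfolding xy seg.simps project_T1.simps r_def [symmetric]
      by (intro eta_eq_max divide_pos_pos geom_mean_pos pos r)
    also have "\<dots> = max ((v - u) * d1 - k) (max ((v - u) * d2 - k) ((v - u) * d3 - k))"
      using pos by (simp only: ln_diff d1_def d2_def d3_def)
    also have "\<dots> = max ((v - u) * d1) (max ((v - u) * d2) ((v - u) * d3)) - k"
      by (simp only: max_diff_distrib_left)
    \<comment> \<open>The factor \<open>v - u\<close> leaves the maximum because it is nonnegative;
      this is where the direction of time enters.\<close>
    also have "\<dots> = (v - u) * max d1 (max d2 d3) - (ln (r v) - ln (r u))"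
      using that by (simp add: max_mult_distrib_left k_def)
    finally show ?thesis .
  qed
  then show thesis
    by (rule that [where c = "\<lambda>t. ln (r t)"])
qed

text \<open>By \<open>symmetrized_eta\<close> the metric is the sup distance of the logarithms of
  the coordinates, and \<open>ln\<close> is continuous at positive reals.\<close>

lemma continuous_map_T1:
  assumes T1: "\<And>t. t \<in> S \<Longrightarrow> (f t, g t, h t) \<in> T1"
    and cont: "continuous_on S f" "continuous_on S g" "continuous_on S h"
  shows "continuous_map (top_of_set S) (Metric_space.mtopology T1 (symmetrized T1 eta))
           (\<lambda>t. (f t, g t, h t))"
proof -
  interpret Metric_space T1 "symmetrized T1 eta"
    by (rule Metric_space_T1)
  have pos: "f t > 0 \<and> g t > 0 \<and> h t > 0" if "t \<in> S" for t
    using T1 [OF that] by (simp add: T1_def)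
  show ?thesis
    unfolding continuous_map_to_metric
  proof (intro ballI allI impI)
    fix t and e :: real
    assume "t \<in> topspace (top_of_set S)" and e: "e > 0"
    then have t: "t \<in> S"
      by simp
    \<comment> \<open>On \<open>S\<close>, \<open>k s\<close> is the distance from the value at
      \<open>t\<close>, so its sublevel set below \<open>e\<close> is the required
      neighbourhood.\<close>
    define k where "k s = max \<bar>ln (f s) - ln (f t)\<bar> (max \<bar>ln (g s) - ln (g t)\<bar> \<bar>ln (h s) - ln (h t)\<bar>)"
      for s
    have "continuous_on S k"
      unfolding k_def by (intro continuous_intros cont) (use pos in fastforce)+
    then have "openin (top_of_set S) (S \<inter> k -` {..<e})"
      by (intro continuous_openin_preimage_gen) auto
    moreover have "(f s, g s, h s) \<in> mball (f t, g t, h t) e" if "s \<in> S \<inter> k -` {..<e}" for s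
      using that t T1 by (simp add: symmetrized_eta k_def)
    moreover have "t \<in> S \<inter> k -` {..<e}"
      using t e by (simp add: k_def)
    ultimately show "\<exists>U. openin (top_of_set S) U \<and> t \<in> U \<and>
        (\<forall>s\<in>U. (f s, g s, h s) \<in> mball (f t, g t, h t) e)"
      by blast
  qed
qed

lemma continuous_map_seg:
  assumes "x \<in> T1" "y \<in> T1"
  shows "continuous_map (top_of_set S) (Metric_space.mtopology T1 (symmetrized T1 eta)) (seg x y)"
proof -
  obtain A1 A2 A3 B1 B2 B3 where xy: "x = (A1, A2, A3)" "y = (B1, B2, B3)"
    by (cases x; cases y) auto
  have pos: "A1 > 0" "A2 > 0" "A3 > 0" "B1 > 0" "B2 > 0" "B3 > 0"
    using assms xy by (auto simp: T1_def)
  define r where "r t = area_root (geom_mean A1 B1 t) (geom_mean A2 B2 t) (geom_mean A3 B3 t)" for t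
  have r: "r t > 0" for t
    using pos by (simp add: r_def area_root_pos geom_mean_pos)
  have gt: "geom_mean A1 B1 t > 0" "geom_mean A2 B2 t > 0" "geom_mean A3 B3 t > 0" for t
    using pos by (simp_all add: geom_mean_pos)
  have gc: "continuous_on S (geom_mean A1 B1)" "continuous_on S (geom_mean A2 B2)"
    "continuous_on S (geom_mean A3 B3)"
    using pos by (simp_all add: continuous_on_geom_mean)
  \<comment> \<open>Provides the nonzero base for the continuity of \<open>powr\<close> in
    \<open>area_root\<close>.\<close>
  have "(geom_mean A1 B1 t + geom_mean A2 B2 t + geom_mean A3 B3 t) *
      geom_mean A1 B1 t * geom_mean A2 B2 t * geom_mean A3 B3 t > 0" for t
    using gt [of t] by simp
  then have rc: "continuous_on S r"
    unfolding r_def area_root_def by (intro continuous_intros gc) (simp add: less_le)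
  have seg: "seg x y = (\<lambda>t. (geom_mean A1 B1 t / r t, geom_mean A2 B2 t / r t, geom_mean A3 B3 t / r t))"
    by (simp add: xy project_T1.simps r_def fun_eq_iff)
  show ?thesis
    unfolding seg
  proof (rule continuous_map_T1)
    show "(geom_mean A1 B1 t / r t, geom_mean A2 B2 t / r t, geom_mean A3 B3 t / r t) \<in> T1" for t
      using seg_in_T1 [OF assms, of t] by (simp add: seg)
  qed (intro continuous_intros gc rc; use r in \<open>simp add: less_le\<close>)+
qed

lemma geodesic_seg:
  assumes "x \<in> T1" "y \<in> T1"
  shows "geodesic_on T1 eta 0 1 (seg x y)"
proof -
  obtain D c where eta:
    "\<And>u v. u \<le> v \<Longrightarrow> eta (seg x y u) (seg x y v) = (v - u) * D - (c v - c u)"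
    using eta_seg [OF assms] by blast
  have "eta (seg x y u) (seg x y w) = eta (seg x y u) (seg x y v) + eta (seg x y v) (seg x y w)"
    if "u \<le> v" "v \<le> w" for u v w
    using that by (simp add: eta) (simp add: algebra_simps)
  then show ?thesis
    using continuous_map_seg [OF assms] by (simp add: geodesic_on_def)
qed

theorem corollary3p5:
  assumes "x \<in> T1" and "y \<in> T1" and "x \<noteq> y"
  shows "\<exists>a b \<alpha>. bigeodesic_on T1 eta a b \<alpha> \<and> \<alpha> a = x \<and> \<alpha> b = y"
proof (intro exI conjI)
  \<comment> \<open>On the interval from 0 to 1 the reversed path is \<open>seg y x\<close>, so
    \<open>geodesic_seg\<close> is used once for each order of the endpoints.\<close>
  show "bigeodesic_on T1 eta 0 1 (seg x y)"
    using geodesic_seg assms by (simp add: bigeodesic_on_def seg_commute)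
  show "seg x y 0 = x"
    using assms by (simp add: seg_0)
  show "seg x y 1 = y"
    using assms seg_commute [of x y 0] by (simp add: seg_0)
qed

end
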